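(* Let $\alpha_1,\dots,\alpha_M>0$, let $Z_1,\dots,Z_M$ be symmetric positive definite with $Z_j\in\mathbb R^{n_j\times n_j}$, and let $i\in\mathcal M$. (1) For each $\ell=1,\dots,n_{g,i}$, the $\ell$-th state constraint $$G^\ell_{\mathcal N_i}x_{\mathcal N_i}\le g^\ell_{\mathcal N_i}\quad\text{for all }x_{\mathcal N_i}\in\widehat{\mathcal X}_{f,\mathcal N_i}(\alpha_{\mathcal N_i})$$ holds if there exist scalars $\tau^\ell_{ij}\ge0$, $j\in\mathcal N_i$, such that $$\begin{bmatrix} g^\ell_{\mathcal N_i} & G^\ell_{\mathcal N_i}\alpha^{1/2}_{\mathcal N_i}\\ \alpha^{1/2}_{\mathcal N_i}(G^\ell_{\mathcal N_i})^\top & \sum_{j\in\mathcal N_i}\tau^\ell_{ij}Z_{ij}\end{bmatrix}\succeq0\quad\text{and}\quad\sum_{j\in\mathcal N_i}\tau^\ell_{ij}\le g^\ell_{\mathcal N_i}.$$ (2) For $K_{\mathcal N_i}\in\mathbb R^{m_i\times n_{\mathcal N_i}}$ and each $\ell=1,\dots,n_{h,i}$, the $\ell$-th input constraint $$H_i^\ell K_{\mathcal N_i}x_{\mathcal N_i}\le h_i^\ell\quad\text{for all }x_{\mathcal N_i}\in\widehat{\mathcal X}_{f,\mathcal N_i}(\alpha_{\mathcal N_i})$$ holds if there exist scalars $\rho^\ell_{ij}\ge0$, $j\in\mathcal N_i$, such that $$\begin{bmatrix} h^\ell_{i} & H^\ell_{i}K_{\mathcal N_i}\alpha^{1/2}_{\mathcal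 N_i}\\ \alpha^{1/2}_{\mathcal N_i}K_{\mathcal N_i}^\top (H^\ell_{i})^\top & \sum_{j\in\mathcal N_i}\rho^\ell_{ij}Z_{ij}\end{bmatrix}\succeq0\quad\text{and}\quad\sum_{j\in\mathcal N_i}\rho^\ell_{ij}\le h^\ell_{i}.$$
   Context: Setting: $\mathcal M=\{1,\dots,M\}$ indexes subsystems; $x=[x_1^\top,\dots,x_M^\top]^\top\in\mathbb R^n$ with $x_i\in\mathbb R^{n_i}$. For each $i$, $\mathcal N_i\subseteq\mathcal M$ is the set of neighbors of subsystem $i$, and $x_{\mathcal N_i}\in\mathbb R^{n_{\mathcal N_i}}$ is the concatenation of the $x_j$, $j\in\mathcal N_i$. $U_i\in\{0,1\}^{n_i\times n}$ and $W_{\mathcal N_i}\in\{0,1\}^{n_{\mathcal N_i}\times n}$ are the selection matrices with $x_i=U_ix$ and $x_{\mathcal N_i}=W_{\mathcal N_i}x$. Subsystem $i$ has input $u_i\in\mathbb R^{m_i}$, state constraints $\mathcal X_{\mathcal N_i}=\{x_{\mathcal N_i}: G_{\mathcal N_i}x_{\mathcal N_i}\le g_{\mathcal N_i}\}$ ($n_{g,i}$ rows) and input constraints $\mathcal U_i=\{u_i: H_iu_i\le h_i\}$ ($n_{h,i}$ rows); a superscript $\ell$ denotes the $\ell$-th row (entry). The constraint sets contain the origin in their interior. The terminal controller is $u_i=K_{\mathcal N_i}x_{\mathcal N_i}$. Terminal sets: $\widehat{\mathcal X}_{f,j}(\alpha_j)=\{x_j\in\mathbb R^{n_j}: x_j^\top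 Z_jx_j\le\alpha_j\}$ and $\widehat{\mathcal X}_{f,\mathcal N_i}(\alpha_{\mathcal N_i})$ is the product of the sets $\widehat{\mathcal X}_{f,j}(\alpha_j)$ over $j\in\mathcal N_i$. Notation: $\alpha=\mathrm{diag}(\alpha_1I_{n_1},\dots,\alpha_MI_{n_M})$, $\alpha_{\mathcal N_i}=W_{\mathcal N_i}\alpha W_{\mathcal N_i}^\top$, so $\alpha_{\mathcal N_i}^{1/2}$ is block diagonal with blocks $\alpha_j^{1/2}I_{n_j}$, $j\in\mathcal N_i$. $Z_{ij}=W_{\mathcal N_i}U_j^\top Z_jU_jW_{\mathcal N_i}^\top$, so that $x_{\mathcal N_i}^\top Z_{ij}x_{\mathcal N_i}=x_j^\top Z_jx_j$ for $j\in\mathcal N_i$. $\succeq 0$ means symmetric positive semidefinite. *)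

theory Defs
  imports Complex_Main "Jordan_Normal_Form.Matrix"
begin

(* Subsystems are numbered 1..M, and n j is the state dimension of subsystem j.  Rows and entries
   of matrices and vectors are numbered from 0, as in the library. *)

section \<open>Stacked vectors and selection matrices\<close>

definition block_vec :: "nat list \<Rightarrow> (nat \<Rightarrow> real vec) \<Rightarrow> real vec" where
  "block_vec J x = foldr (@\<^sub>v) (map x J) vNil"

(* Neighbouring blocks are stacked in increasing order of their index. *)
definition nbr_vec :: "nat set \<Rightarrow> (nat \<Rightarrow> real vec) \<Rightarrow> real vec" where
  "nbr_vec S x = block_vec (sorted_list_of_set S) x"

definition sel_U :: "nat \<Rightarrow> (nat \<Rightarrow> nat) \<Rightarrow> nat \<Rightarrow> real mat" where
  "sel_U M n j = mat (n j) (\<Sum>k\<in>{1..M}. n k) (\<lambda>(r, c). if c = (\<Sum>k\<in>{1..<j}. n k) + r then 1 else 0)"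

definition sel_W :: "nat \<Rightarrow> (nat \<Rightarrow> nat) \<Rightarrow> nat set \<Rightarrow> real mat" where
  "sel_W M n S = foldr (@\<^sub>r) (map (sel_U M n) (sorted_list_of_set S)) (0\<^sub>m 0 (\<Sum>k\<in>{1..M}. n k))"

section \<open>Definiteness, matrix sums and constraint sets\<close>

definition pos_semidef :: "nat \<Rightarrow> real mat \<Rightarrow> bool" where
  "pos_semidef d A \<longleftrightarrow> A \<in> carrier_mat d d \<and> A\<^sup>T = A \<and> (\<forall>v\<in>carrier_vec d. 0 \<le> v \<bullet> (A *\<^sub>v v))"

definition pos_def :: "nat \<Rightarrow> real mat \<Rightarrow> bool" where
  "pos_def d A \<longleftrightarrow>
     A \<in> carrier_mat d d \<and> A\<^sup>T = A \<and> (\<forall>v\<in>carrier_vec d. v \<noteq> 0\<^sub>v d \<longrightarrow> 0 < v \<bullet> (A *\<^sub>v v))"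

(* The library type of matrices has no additive unit, so sums over index sets are taken entrywise. *)
definition mat_sum :: "nat \<Rightarrow> (nat \<Rightarrow> real mat) \<Rightarrow> nat set \<Rightarrow> real mat" where
  "mat_sum d A S = mat d d (\<lambda>rc. \<Sum>j\<in>S. A j $$ rc)"

definition polyhedron :: "nat \<Rightarrow> real mat \<Rightarrow> real vec \<Rightarrow> real vec set" where
  "polyhedron d A b = {v \<in> carrier_vec d. A *\<^sub>v v \<le> b}"

(* The type of vectors of arbitrary dimension carries no topology: the origin is interior to S
   if S contains a Euclidean ball around it. *)
definition origin_in_interior :: "nat \<Rightarrow> real vec set \<Rightarrow> bool" where
  "origin_in_interior d S \<longleftrightarrow> (\<exists>\<epsilon>>0. \<forall>v\<in>carrier_vec d. sqrt (v \<bullet> v) < \<epsilon> \<longrightarrow> v \<in> S)"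

section \<open>Terminal sets and the matrices of the LMIs\<close>

definition term_set :: "nat \<Rightarrow> real mat \<Rightarrow> real \<Rightarrow> real vec set" where
  "term_set d Z a = {v \<in> carrier_vec d. v \<bullet> (Z *\<^sub>v v) \<le> a}"

definition nbr_term_set ::
  "(nat \<Rightarrow> nat) \<Rightarrow> (nat \<Rightarrow> real mat) \<Rightarrow> (nat \<Rightarrow> real) \<Rightarrow> nat set \<Rightarrow> real vec set" where
  "nbr_term_set n Z \<alpha> S = {nbr_vec S x | x. \<forall>j\<in>S. x j \<in> term_set (n j) (Z j) (\<alpha> j)}"

definition alpha_mat :: "nat \<Rightarrow> (nat \<Rightarrow> nat) \<Rightarrow> (nat \<Rightarrow> real) \<Rightarrow> real mat" where
  "alpha_mat M n \<alpha> = diag_block_mat (map (\<lambda>j. \<alpha> j \<cdot>\<^sub>m 1\<^sub>m (n j)) [1..<Suc M])"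

definition alpha_nbr :: "nat \<Rightarrow> (nat \<Rightarrow> nat) \<Rightarrow> (nat \<Rightarrow> real) \<Rightarrow> nat set \<Rightarrow> real mat" where
  "alpha_nbr M n \<alpha> S = sel_W M n S * alpha_mat M n \<alpha> * (sel_W M n S)\<^sup>T"

(* This is the square root of alpha_nbr; see alpha_nbr_sqrt_square and pos_semidef_alpha_nbr_sqrt. *)
definition alpha_nbr_sqrt :: "(nat \<Rightarrow> nat) \<Rightarrow> (nat \<Rightarrow> real) \<Rightarrow> nat set \<Rightarrow> real mat" where
  "alpha_nbr_sqrt n \<alpha> S = diag_block_mat (map (\<lambda>j. sqrt (\<alpha> j) \<cdot>\<^sub>m 1\<^sub>m (n j)) (sorted_list_of_set S))"

definition Z_nbr :: "nat \<Rightarrow> (nat \<Rightarrow> nat) \<Rightarrow> (nat \<Rightarrow> real mat) \<Rightarrow> nat set \<Rightarrow> nat \<Rightarrow> real mat" where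
  "Z_nbr M n Z S j = sel_W M n S * (sel_U M n j)\<^sup>T * Z j * sel_U M n j * (sel_W M n S)\<^sup>T"

(* [ b       r A ]
   [ A r^T   Q   ]   for a 1 x p row r and a symmetric p x p matrix A *)
definition lmi_mat :: "real \<Rightarrow> real mat \<Rightarrow> real mat \<Rightarrow> real mat \<Rightarrow> real mat" where
  "lmi_mat b r A Q = four_block_mat (mat 1 1 (\<lambda>_. b)) (r * A) (A * r\<^sup>T) Q"


section \<open>The explicit definitions have the defining properties\<close>

lemma block_vec_Nil [simp]: "block_vec [] x = vNil"
  by (simp add: block_vec_def)

lemma block_vec_Cons [simp]: "block_vec (j # J) x = x j @\<^sub>v block_vec J x"
  by (simp add: block_vec_def)

lemma block_vec_carrier:
  "(\<And>j. j \<in> set J \<Longrightarrow> x j \<in> carrier_vec (n j)) \<Longrightarrow> block_vec J x \<in> carrier_vec (sum_list (map n J))"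
proof (induction J)
  case (Cons j J)
  then have "x j \<in> carrier_vec (n j)" "block_vec J x \<in> carrier_vec (sum_list (map n J))" by auto
  then show ?case by simp
qed simp

lemma block_vec_cong: "(\<And>j. j \<in> set J \<Longrightarrow> x j = y j) \<Longrightarrow> block_vec J x = block_vec J y"
  by (induction J) auto

lemma block_vec_scalar_prod:
  assumes "\<And>j. j \<in> set J \<Longrightarrow> x j \<in> carrier_vec (n j)" "\<And>j. j \<in> set J \<Longrightarrow> y j \<in> carrier_vec (n j)"
  shows "block_vec J x \<bullet> block_vec J y = (\<Sum>j\<leftarrow>J. x j \<bullet> y j)"
  using assms
proof (induction J)
  case Nil
  then show ?case by (simp add: scalar_prod_def)
next
  case (Cons j J)
  have "block_vec J x \<in> carrier_vec (sum_list (map n J))" "block_vec J y \<in> carrier_vec (sum_list (map n J))"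
    using Cons.prems by (auto intro!: block_vec_carrier)
  then have "block_vec (j # J) x \<bullet> block_vec (j # J) y = x j \<bullet> y j + block_vec J x \<bullet> block_vec J y"
    using Cons.prems by (simp add: scalar_prod_append[of _ "n j" _ "sum_list (map n J)"])
  then show ?case using Cons by simp
qed

lemma block_vec_exists:
  assumes "v \<in> carrier_vec (sum_list (map n J))" "distinct J"
  shows "\<exists>x. (\<forall>j. x j \<in> carrier_vec (n j)) \<and> v = block_vec J x"
  using assms
proof (induction J arbitrary: v)
  case Nil
  then have "v = vNil" by (intro eq_vecI) auto
  moreover have "\<exists>x :: nat \<Rightarrow> real vec. \<forall>j. x j \<in> carrier_vec (n j)"
    by (rule exI[of _ "\<lambda>j. 0\<^sub>v (n j)"]) simp
  ultimately show ?case by simp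
next
  case (Cons j J)
  let ?a = "vec_first v (n j)" and ?b = "vec_last v (sum_list (map n J))"
  have v: "v = ?a @\<^sub>v ?b" using Cons.prems by simp
  obtain x where x: "\<forall>j. x j \<in> carrier_vec (n j)" "?b = block_vec J x"
    using Cons.IH[of ?b] Cons.prems by auto
  have "block_vec J (x(j := ?a)) = block_vec J x"
    using Cons.prems by (intro block_vec_cong) auto
  then have "v = block_vec (j # J) (x(j := ?a))" using v x by simp
  moreover have "\<forall>k. (x(j := ?a)) k \<in> carrier_vec (n k)" using x by simp
  ultimately show ?case by blast
qed

lemma block_vec_index:
  assumes "\<And>k. k \<in> set (J @ j # J') \<Longrightarrow> x k \<in> carrier_vec (n k)" "r < n j"
  shows "block_vec (J @ j # J') x $ (sum_list (map n J) + r) = x j $ r"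
  using assms
proof (induction J)
  case Nil
  have "block_vec J' x \<in> carrier_vec (sum_list (map n J'))"
    using Nil by (intro block_vec_carrier) auto
  moreover have "x j \<in> carrier_vec (n j)" using Nil by simp
  ultimately show ?case using Nil(2) by (simp add: carrier_vecD)
next
  case (Cons k J)
  have c: "block_vec (J @ j # J') x \<in> carrier_vec (sum_list (map n (J @ j # J')))"
    using Cons.prems by (intro block_vec_carrier) auto
  have xk: "x k \<in> carrier_vec (n k)" using Cons.prems by simp
  have "block_vec ((k # J) @ j # J') x $ (sum_list (map n (k # J)) + r)
      = block_vec (J @ j # J') x $ (sum_list (map n J) + r)"
    using carrier_vecD[OF c] carrier_vecD[OF xk] Cons.prems(2) by simp
  also have "\<dots> = x j $ r" using Cons.prems by (intro Cons.IH) auto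
  finally show ?case .
qed

lemma sum_list_full: "sum_list (map n [1..<Suc M]) = (\<Sum>k\<in>{1..M}. n k)" for n :: "nat \<Rightarrow> nat"
  by (simp only: interv_sum_list_conv_sum_set_nat set_upt atLeastLessThanSuc_atLeastAtMost)

lemma sum_list_nbr:
  "finite S \<Longrightarrow> sum_list (map n (sorted_list_of_set S)) = (\<Sum>k\<in>S. n k)" for n :: "nat \<Rightarrow> nat"
  by (simp add: sum_list_distinct_conv_sum_set)

lemma full_carrier:
  "\<forall>k\<in>{1..M}. x k \<in> carrier_vec (n k) \<Longrightarrow> block_vec [1..<Suc M] x \<in> carrier_vec (\<Sum>k\<in>{1..M}. n k)"
  using block_vec_carrier[of "[1..<Suc M]" x n] unfolding sum_list_full by (auto simp del: One_nat_def upt_Suc)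

lemma nbr_vec_carrier:
  "finite S \<Longrightarrow> \<forall>k\<in>S. x k \<in> carrier_vec (n k) \<Longrightarrow> nbr_vec S x \<in> carrier_vec (\<Sum>k\<in>S. n k)"
  using block_vec_carrier[of "sorted_list_of_set S" x n] by (simp add: nbr_vec_def sum_list_nbr)

lemma nbr_vec_exists:
  assumes "finite S" "v \<in> carrier_vec (\<Sum>k\<in>S. n k)"
  obtains x where "\<forall>j. x j \<in> carrier_vec (n j)" "v = nbr_vec S x"
  using block_vec_exists[of v n "sorted_list_of_set S"] assms by (auto simp: nbr_vec_def sum_list_nbr)

lemma sel_U_carrier: "sel_U M n j \<in> carrier_mat (n j) (\<Sum>k\<in>{1..M}. n k)"
  by (simp add: sel_U_def)

lemma sel_U_mult:
  assumes x: "\<forall>k\<in>{1..M}. x k \<in> carrier_vec (n k)" and j: "j \<in> {1..M}"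
  shows "sel_U M n j *\<^sub>v block_vec [1..<Suc M] x = x j"
proof (rule eq_vecI)
  have xj: "x j \<in> carrier_vec (n j)" using x j by blast
  then show "dim_vec (sel_U M n j *\<^sub>v block_vec [1..<Suc M] x) = dim_vec (x j)"
    by (simp add: sel_U_def)
  let ?n = "\<Sum>k\<in>{1..M}. n k" and ?o = "\<Sum>k\<in>{1..<j}. n k" and ?v = "block_vec [1..<Suc M] x"
  fix r assume "r < dim_vec (x j)"
  then have r: "r < n j" using xj by simp
  have split: "[1..<Suc M] = [1..<j] @ j # [Suc j..<Suc M]"
    using j upt_add_eq_append[of 1 j "Suc M - j"] by (simp add: upt_conv_Cons del: upt_Suc)
  have off: "sum_list (map n [1..<j]) = ?o"
    by (simp only: interv_sum_list_conv_sum_set_nat set_upt)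
  have "?n = ?o + n j + sum_list (map n [Suc j..<Suc M])"
    unfolding sum_list_full[symmetric] split using off by simp
  then have lt: "?o + r < ?n" using r by simp
  have v: "?v \<in> carrier_vec ?n" using x by (rule full_carrier)
  have "(sel_U M n j *\<^sub>v ?v) $ r = (\<Sum>c\<in>{0..<?n}. (if c = ?o + r then 1 else 0) * ?v $ c)"
  proof -
    have "(sel_U M n j *\<^sub>v ?v) $ r = row (sel_U M n j) r \<bullet> ?v"
      using r by (intro index_mult_mat_vec) (simp add: sel_U_def)
    also have "\<dots> = (\<Sum>c\<in>{0..<?n}. row (sel_U M n j) r $ c * ?v $ c)"
      unfolding scalar_prod_def carrier_vecD[OF v] ..
    also have "\<dots> = (\<Sum>c\<in>{0..<?n}. (if c = ?o + r then 1 else 0) * ?v $ c)"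
      using r by (intro sum.cong refl) (simp add: sel_U_def)
    finally show ?thesis .
  qed
  also have "\<dots> = (\<Sum>c\<in>{0..<?n}. if c = ?o + r then ?v $ c else 0)"
    by (intro sum.cong refl) simp
  also have "\<dots> = ?v $ (?o + r)"
    using sum.delta[of "{0..<?n}" "?o + r" "\<lambda>c. ?v $ c"] lt
    by (simp only: finite_atLeastLessThan atLeastLessThan_iff le0 simp_thms if_True)
  also have "\<dots> = x j $ r"
    unfolding split off[symmetric] using x r j by (intro block_vec_index) auto
  finally show "(sel_U M n j *\<^sub>v ?v) $ r = x j $ r" .
qed

lemma stack_rows_carrier:
  "foldr (@\<^sub>r) (map (sel_U M n) J) (0\<^sub>m 0 (\<Sum>k\<in>{1..M}. n k))
     \<in> carrier_mat (sum_list (map n J)) (\<Sum>k\<in>{1..M}. n k)"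
  by (induction J) (auto simp del: One_nat_def intro!: sel_U_carrier)

lemma sel_W_carrier:
  "finite S \<Longrightarrow> sel_W M n S \<in> carrier_mat (\<Sum>k\<in>S. n k) (\<Sum>k\<in>{1..M}. n k)"
  using stack_rows_carrier[of M n "sorted_list_of_set S"] by (simp add: sel_W_def sum_list_nbr)

lemma sel_W_mult:
  assumes x: "\<forall>k\<in>{1..M}. x k \<in> carrier_vec (n k)" and S: "S \<subseteq> {1..M}"
  shows "sel_W M n S *\<^sub>v block_vec [1..<Suc M] x = nbr_vec S x"
proof -
  let ?v = "block_vec [1..<Suc M] x"
  have v: "?v \<in> carrier_vec (\<Sum>k\<in>{1..M}. n k)" using x by (rule full_carrier)
  have "foldr (@\<^sub>r) (map (sel_U M n) J) (0\<^sub>m 0 (\<Sum>k\<in>{1..M}. n k)) *\<^sub>v ?v = block_vec J x"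
    if "set J \<subseteq> {1..M}" for J
    using that
  proof (induction J)
    case Nil
    show ?case by (intro eq_vecI) auto
  next
    case (Cons j J)
    then show ?case
      using mat_mult_append[OF sel_U_carrier stack_rows_carrier v, of j J] sel_U_mult[OF x, of j] by simp
  qed
  moreover have "set (sorted_list_of_set S) \<subseteq> {1..M}"
    using S finite_subset[OF S] by simp
  ultimately show ?thesis by (simp add: sel_W_def nbr_vec_def)
qed

lemma sel_W_transpose_mult:
  assumes x: "\<forall>k. x k \<in> carrier_vec (n k)" and S: "S \<subseteq> {1..M}"
  shows "(sel_W M n S)\<^sup>T *\<^sub>v nbr_vec S x = block_vec [1..<Suc M] (\<lambda>k. if k \<in> S then x k else 0\<^sub>v (n k))"
    (is "?l = block_vec _ ?x")
proof -
  let ?n = "\<Sum>k\<in>{1..M}. n k"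
  have fin: "finite S" using S finite_subset by blast
  have W: "sel_W M n S \<in> carrier_mat (\<Sum>k\<in>S. n k) ?n" using fin by (rule sel_W_carrier)
  have xS: "nbr_vec S x \<in> carrier_vec (\<Sum>k\<in>S. n k)" using x fin by (intro nbr_vec_carrier) auto
  have r: "block_vec [1..<Suc M] ?x \<in> carrier_vec ?n" using x by (intro full_carrier) auto
  have dot: "?l \<bullet> v = block_vec [1..<Suc M] ?x \<bullet> v" if v: "v \<in> carrier_vec ?n" for v
  proof -
    obtain y where y: "\<forall>j. y j \<in> carrier_vec (n j)" "v = block_vec [1..<Suc M] y"
      using block_vec_exists[of v n "[1..<Suc M]"] v distinct_upt unfolding sum_list_full by blast
    have "?l \<bullet> v = nbr_vec S x \<bullet> (sel_W M n S *\<^sub>v v)"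
      using transpose_vec_mult_scalar[OF W v xS] .
    also have "\<dots> = nbr_vec S x \<bullet> nbr_vec S y"
      unfolding y(2) using y(1) S by (subst sel_W_mult) auto
    also have "\<dots> = (\<Sum>j\<in>S. x j \<bullet> y j)"
      unfolding nbr_vec_def using x y(1) fin
      by (subst block_vec_scalar_prod[of _ _ n]) (auto simp: sum_list_distinct_conv_sum_set)
    also have "\<dots> = (\<Sum>j\<in>{1..M}. if j \<in> S then x j \<bullet> y j else 0)"
      using S by (simp add: sum.inter_restrict[symmetric] Int_absorb1)
    also have "\<dots> = (\<Sum>j\<in>{1..M}. ?x j \<bullet> y j)"
      using y(1) by (intro sum.cong) auto
    also have "\<dots> = (\<Sum>j\<leftarrow>[1..<Suc M]. ?x j \<bullet> y j)"
      by (simp only: interv_sum_list_conv_sum_set_nat set_upt atLeastLessThanSuc_atLeastAtMost)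
    also have "\<dots> = block_vec [1..<Suc M] ?x \<bullet> v"
      unfolding y(2) using x y(1) by (subst block_vec_scalar_prod[of _ _ n]) auto
    finally show ?thesis .
  qed
  have l: "?l \<in> carrier_vec ?n" using W xS by simp
  show ?thesis
  proof (rule eq_vecI)
    show "dim_vec ?l = dim_vec (block_vec [1..<Suc M] ?x)"
      unfolding carrier_vecD[OF l] carrier_vecD[OF r] ..
    fix c assume "c < dim_vec (block_vec [1..<Suc M] ?x)"
    then have c: "c < ?n" unfolding carrier_vecD[OF r] .
    show "?l $ c = block_vec [1..<Suc M] ?x $ c"
      using dot[OF unit_vec_carrier, of c]
      unfolding scalar_prod_right_unit[OF c] .
  qed
qed

lemma sel_U_sel_W_transpose_mult:
  assumes x: "\<forall>k. x k \<in> carrier_vec (n k)" and S: "S \<subseteq> {1..M}" and j: "j \<in> S"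
  shows "sel_U M n j *\<^sub>v ((sel_W M n S)\<^sup>T *\<^sub>v nbr_vec S x) = x j"
  unfolding sel_W_transpose_mult[OF x S] using x S j by (subst sel_U_mult) auto

lemma Z_nbr_quadratic_form:
  assumes x: "\<forall>k\<in>S. x k \<in> carrier_vec (n k)" and S: "S \<subseteq> {1..M}" and j: "j \<in> S"
    and Z: "Z j \<in> carrier_mat (n j) (n j)"
  shows "nbr_vec S x \<bullet> (Z_nbr M n Z S j *\<^sub>v nbr_vec S x) = x j \<bullet> (Z j *\<^sub>v x j)"
proof -
  have fin: "finite S" using S finite_subset by blast
  define y where "y = (\<lambda>k. if k \<in> S then x k else 0\<^sub>v (n k))"
  have y: "\<forall>k. y k \<in> carrier_vec (n k)" using x by (simp add: y_def)
  have xy: "nbr_vec S x = nbr_vec S y"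
    unfolding nbr_vec_def using fin by (intro block_vec_cong) (simp add: y_def)
  let ?s = "\<Sum>k\<in>S. n k" and ?n = "\<Sum>k\<in>{1..M}. n k" and ?W = "sel_W M n S" and ?U = "sel_U M n j"
  let ?v = "nbr_vec S y"
  have W: "?W \<in> carrier_mat ?s ?n" and U: "?U \<in> carrier_mat (n j) ?n"
    using sel_W_carrier[OF fin] sel_U_carrier by blast+
  have v: "?v \<in> carrier_vec ?s" using y fin by (intro nbr_vec_carrier) auto
  have Uv: "?U *\<^sub>v (?W\<^sup>T *\<^sub>v ?v) = y j" using y S j by (rule sel_U_sel_W_transpose_mult)
  have WT: "?W\<^sup>T \<in> carrier_mat ?n ?s" and UT: "?U\<^sup>T \<in> carrier_mat ?n (n j)" using W U by auto
  have P1: "?W * ?U\<^sup>T \<in> carrier_mat ?s (n j)" using W UT by simp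
  have P2: "?W * ?U\<^sup>T * Z j \<in> carrier_mat ?s (n j)" using P1 Z by simp
  have P3: "?W * ?U\<^sup>T * Z j * ?U \<in> carrier_mat ?s ?n" using P2 U by (rule mult_carrier_mat)
  have Wv: "?W\<^sup>T *\<^sub>v ?v \<in> carrier_vec ?n" using WT v by simp
  have UWv: "?U *\<^sub>v (?W\<^sup>T *\<^sub>v ?v) \<in> carrier_vec (n j)" using U Wv by simp
  have ZUWv: "Z j *\<^sub>v (?U *\<^sub>v (?W\<^sup>T *\<^sub>v ?v)) \<in> carrier_vec (n j)" using Z UWv by simp
  have "Z_nbr M n Z S j *\<^sub>v ?v = ?W *\<^sub>v (?U\<^sup>T *\<^sub>v (Z j *\<^sub>v (?U *\<^sub>v (?W\<^sup>T *\<^sub>v ?v))))"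
    unfolding Z_nbr_def
    by (simp only: assoc_mult_mat_vec[OF P3 WT v] assoc_mult_mat_vec[OF P2 U Wv]
        assoc_mult_mat_vec[OF P1 Z UWv] assoc_mult_mat_vec[OF W UT ZUWv])
  then have eq: "Z_nbr M n Z S j *\<^sub>v ?v = ?W *\<^sub>v (?U\<^sup>T *\<^sub>v (Z j *\<^sub>v y j))" using Uv by simp
  have zy: "Z j *\<^sub>v y j \<in> carrier_vec (n j)" using Z y by simp
  have u: "?U\<^sup>T *\<^sub>v (Z j *\<^sub>v y j) \<in> carrier_vec ?n" using UT zy by simp
  have "?v \<bullet> (?W *\<^sub>v (?U\<^sup>T *\<^sub>v (Z j *\<^sub>v y j))) = (?W\<^sup>T *\<^sub>v ?v) \<bullet> (?U\<^sup>T *\<^sub>v (Z j *\<^sub>v y j))"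
    using transpose_vec_mult_scalar[OF W u v] by simp
  also have "\<dots> = (?U\<^sup>T *\<^sub>v (Z j *\<^sub>v y j)) \<bullet> (?W\<^sup>T *\<^sub>v ?v)"
    using u Wv by (rule comm_scalar_prod[rotated])
  also have "\<dots> = (Z j *\<^sub>v y j) \<bullet> (?U *\<^sub>v (?W\<^sup>T *\<^sub>v ?v))"
    using transpose_vec_mult_scalar[OF U Wv zy] .
  also have "\<dots> = y j \<bullet> (Z j *\<^sub>v y j)"
    unfolding Uv using zy y by (intro comm_scalar_prod[of _ "n j"]) auto
  finally show ?thesis using eq xy j by (simp add: y_def)
qed

lemma diag_block_mult:
  assumes "\<And>j. j \<in> set J \<Longrightarrow> x j \<in> carrier_vec (n j)"
  shows "diag_block_mat (map (\<lambda>j. a j \<cdot>\<^sub>m 1\<^sub>m (n j)) J) *\<^sub>v block_vec J x = block_vec J (\<lambda>j. a j \<cdot>\<^sub>v x j)"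
  using assms
proof (induction J)
  case Nil
  show ?case by (intro eq_vecI) auto
next
  case (Cons j J)
  let ?D = "diag_block_mat (map (\<lambda>j. a j \<cdot>\<^sub>m 1\<^sub>m (n j)) J)" and ?s = "sum_list (map n J)"
  have D: "?D \<in> carrier_mat ?s ?s"
    by (intro carrier_matI) (simp_all add: dim_diag_block_mat o_def)
  have b: "block_vec J x \<in> carrier_vec ?s" using Cons.prems by (intro block_vec_carrier) auto
  have xj: "x j \<in> carrier_vec (n j)" using Cons.prems by simp
  have A: "a j \<cdot>\<^sub>m 1\<^sub>m (n j) \<in> carrier_mat (n j) (n j)" by simp
  have ax: "(a j \<cdot>\<^sub>m 1\<^sub>m (n j)) *\<^sub>v x j = a j \<cdot>\<^sub>v x j"
    using xj by (auto intro!: eq_vecI simp: smult_scalar_prod_distrib[of _ "n j"])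
  show ?case
    using mult_mat_vec_split[OF A D xj b] Cons D ax by (simp add: Let_def)
qed

lemma alpha_mat_carrier: "alpha_mat M n \<alpha> \<in> carrier_mat (\<Sum>k\<in>{1..M}. n k) (\<Sum>k\<in>{1..M}. n k)"
  unfolding alpha_mat_def sum_list_full[symmetric]
  by (intro carrier_matI) (simp_all add: dim_diag_block_mat o_def)

lemma alpha_nbr_sqrt_carrier:
  "finite S \<Longrightarrow> alpha_nbr_sqrt n \<alpha> S \<in> carrier_mat (\<Sum>k\<in>S. n k) (\<Sum>k\<in>S. n k)"
  unfolding alpha_nbr_sqrt_def sum_list_nbr[symmetric]
  by (intro carrier_matI) (simp_all add: dim_diag_block_mat o_def)

lemma alpha_nbr_sqrt_mult:
  "finite S \<Longrightarrow> \<forall>k\<in>S. x k \<in> carrier_vec (n k) \<Longrightarrow>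
     alpha_nbr_sqrt n \<alpha> S *\<^sub>v nbr_vec S x = nbr_vec S (\<lambda>k. sqrt (\<alpha> k) \<cdot>\<^sub>v x k)"
  unfolding alpha_nbr_sqrt_def nbr_vec_def by (rule diag_block_mult) auto

lemma mat_eq_by_mult_vec:
  fixes A B :: "real mat"
  assumes A: "A \<in> carrier_mat r c" and B: "B \<in> carrier_mat r c"
    and eq: "\<And>v. v \<in> carrier_vec c \<Longrightarrow> A *\<^sub>v v = B *\<^sub>v v"
  shows "A = B"
proof (rule eq_matI)
  fix p q assume "p < dim_row B" "q < dim_col B"
  then have pq: "p < r" "q < c" using B by auto
  have "(A *\<^sub>v unit_vec c q) $ p = (B *\<^sub>v unit_vec c q) $ p" using eq by simp
  then show "A $$ (p, q) = B $$ (p, q)" using A B pq by simp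
qed (use A B in auto)

lemma alpha_nbr_sqrt_square:
  assumes S: "S \<subseteq> {1..M}" and \<alpha>: "\<forall>k\<in>{1..M}. \<alpha> k > 0"
  shows "alpha_nbr_sqrt n \<alpha> S * alpha_nbr_sqrt n \<alpha> S = alpha_nbr M n \<alpha> S"
proof (rule mat_eq_by_mult_vec)
  have fin: "finite S" using S finite_subset by blast
  let ?s = "\<Sum>k\<in>S. n k" and ?n = "\<Sum>k\<in>{1..M}. n k" and ?W = "sel_W M n S" and ?R = "alpha_nbr_sqrt n \<alpha> S"
  have R: "?R \<in> carrier_mat ?s ?s" using fin by (rule alpha_nbr_sqrt_carrier)
  have W: "?W \<in> carrier_mat ?s ?n" using fin by (rule sel_W_carrier)
  have a: "alpha_mat M n \<alpha> \<in> carrier_mat ?n ?n" by (rule alpha_mat_carrier)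
  show "?R * ?R \<in> carrier_mat ?s ?s" using R by simp
  show "alpha_nbr M n \<alpha> S \<in> carrier_mat ?s ?s" unfolding alpha_nbr_def using W a by simp
  fix v :: "real vec" assume v: "v \<in> carrier_vec ?s"
  obtain x where x: "\<forall>k. x k \<in> carrier_vec (n k)" "v = nbr_vec S x"
    using fin v by (rule nbr_vec_exists)
  have "(?R * ?R) *\<^sub>v v = ?R *\<^sub>v (?R *\<^sub>v v)" using R v by simp
  also have "\<dots> = nbr_vec S (\<lambda>k. sqrt (\<alpha> k) \<cdot>\<^sub>v (sqrt (\<alpha> k) \<cdot>\<^sub>v x k))"
    unfolding x(2) using x(1) fin by (simp add: alpha_nbr_sqrt_mult)
  also have "\<dots> = nbr_vec S (\<lambda>k. \<alpha> k \<cdot>\<^sub>v x k)"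
    unfolding nbr_vec_def
  proof (rule block_vec_cong)
    fix k assume "k \<in> set (sorted_list_of_set S)"
    then have "\<alpha> k > 0" using \<alpha> S fin by auto
    then show "sqrt (\<alpha> k) \<cdot>\<^sub>v (sqrt (\<alpha> k) \<cdot>\<^sub>v x k) = \<alpha> k \<cdot>\<^sub>v x k"
      by (simp add: smult_smult_assoc)
  qed
  finally have 1: "(?R * ?R) *\<^sub>v v = nbr_vec S (\<lambda>k. \<alpha> k \<cdot>\<^sub>v x k)" .
  let ?x = "\<lambda>k. if k \<in> S then x k else 0\<^sub>v (n k)"
  have WT: "?W\<^sup>T \<in> carrier_mat ?n ?s" using W by simp
  have Wa: "?W * alpha_mat M n \<alpha> \<in> carrier_mat ?s ?n" using W a by (rule mult_carrier_mat)
  have Wv: "?W\<^sup>T *\<^sub>v v \<in> carrier_vec ?n" using WT v by simp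
  have "alpha_nbr M n \<alpha> S *\<^sub>v v = ?W *\<^sub>v (alpha_mat M n \<alpha> *\<^sub>v (?W\<^sup>T *\<^sub>v v))"
    unfolding alpha_nbr_def by (simp only: assoc_mult_mat_vec[OF Wa WT v] assoc_mult_mat_vec[OF W a Wv])
  also have "\<dots> = ?W *\<^sub>v block_vec [1..<Suc M] (\<lambda>k. \<alpha> k \<cdot>\<^sub>v ?x k)"
    unfolding x(2) sel_W_transpose_mult[OF x(1) S] alpha_mat_def
    using x(1) by (subst diag_block_mult) auto
  also have "\<dots> = nbr_vec S (\<lambda>k. \<alpha> k \<cdot>\<^sub>v ?x k)"
    using x(1) S by (intro sel_W_mult) auto
  also have "\<dots> = nbr_vec S (\<lambda>k. \<alpha> k \<cdot>\<^sub>v x k)"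
    unfolding nbr_vec_def using fin by (intro block_vec_cong) auto
  finally show "(?R * ?R) *\<^sub>v v = alpha_nbr M n \<alpha> S *\<^sub>v v" using 1 by simp
qed

lemma pos_semidef_alpha_nbr_sqrt:
  assumes fin: "finite S" and \<alpha>: "\<forall>k\<in>S. \<alpha> k > 0"
  shows "pos_semidef (\<Sum>k\<in>S. n k) (alpha_nbr_sqrt n \<alpha> S)"
  unfolding pos_semidef_def
proof (intro conjI ballI)
  let ?s = "\<Sum>k\<in>S. n k"
  show R: "alpha_nbr_sqrt n \<alpha> S \<in> carrier_mat ?s ?s" using fin by (rule alpha_nbr_sqrt_carrier)
  have "(diag_block_mat (map (\<lambda>j. sqrt (\<alpha> j) \<cdot>\<^sub>m 1\<^sub>m (n j)) J))\<^sup>T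
      = diag_block_mat (map (\<lambda>j. sqrt (\<alpha> j) \<cdot>\<^sub>m 1\<^sub>m (n j)) J)" for J
  proof (induction J)
    case (Cons j J)
    let ?D = "diag_block_mat (map (\<lambda>j. sqrt (\<alpha> j) \<cdot>\<^sub>m 1\<^sub>m (n j)) J)" and ?d = "sum_list (map n J)"
    have D: "?D \<in> carrier_mat ?d ?d"
      by (intro carrier_matI) (simp_all add: dim_diag_block_mat o_def)
    have t: "(sqrt (\<alpha> j) \<cdot>\<^sub>m 1\<^sub>m (n j))\<^sup>T = sqrt (\<alpha> j) \<cdot>\<^sub>m 1\<^sub>m (n j)" by (intro eq_matI) auto
    show ?case
      using D Cons t
      by (simp add: Let_def transpose_four_block_mat[of _ "n j" "n j" _ ?d _ ?d])
  qed (intro eq_matI, auto)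
  then show "(alpha_nbr_sqrt n \<alpha> S)\<^sup>T = alpha_nbr_sqrt n \<alpha> S" by (simp add: alpha_nbr_sqrt_def)
  fix v :: "real vec" assume v: "v \<in> carrier_vec ?s"
  obtain x where x: "\<forall>k. x k \<in> carrier_vec (n k)" "v = nbr_vec S x"
    using fin v by (rule nbr_vec_exists)
  have "v \<bullet> (alpha_nbr_sqrt n \<alpha> S *\<^sub>v v) = nbr_vec S x \<bullet> nbr_vec S (\<lambda>k. sqrt (\<alpha> k) \<cdot>\<^sub>v x k)"
    unfolding x(2) using x(1) fin by (simp add: alpha_nbr_sqrt_mult)
  also have "\<dots> = (\<Sum>k\<in>S. x k \<bullet> (sqrt (\<alpha> k) \<cdot>\<^sub>v x k))"
    unfolding nbr_vec_def using x(1) fin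
    by (subst block_vec_scalar_prod[of _ _ n]) (auto simp: sum_list_distinct_conv_sum_set)
  also have "\<dots> \<ge> 0"
  proof (rule sum_nonneg)
    fix k assume "k \<in> S"
    then have "sqrt (\<alpha> k) \<ge> 0" using \<alpha> by (simp add: less_imp_le)
    moreover have "x k \<bullet> x k \<ge> 0" by (auto simp: scalar_prod_def intro: sum_nonneg)
    moreover have "x k \<bullet> (sqrt (\<alpha> k) \<cdot>\<^sub>v x k) = sqrt (\<alpha> k) * (x k \<bullet> x k)" by simp
    ultimately show "x k \<bullet> (sqrt (\<alpha> k) \<cdot>\<^sub>v x k) \<ge> 0" by (metis mult_nonneg_nonneg)
  qed
  finally show "0 \<le> v \<bullet> (alpha_nbr_sqrt n \<alpha> S *\<^sub>v v)" .
qed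

end

(* For x in the terminal set put s_j = x_j / sqrt(alpha_j), so that x = alpha^(1/2) s and
   s_j^T Z_j s_j <= 1.  Evaluating the quadratic form of the LMI at the vector (-1, s) gives
   2 r x <= b + sum_j tau_j s_j^T Z_j s_j <= b + sum_j tau_j <= 2 b.  The input constraint is the
   state constraint with r = H K. *)
theory Submission
  imports Defs
begin

text \<open>Since \<open>mat_sum\<close> is entrywise, both sides are the same triple sum over the
  row p, the column q and the index j, in different orders.\<close>

lemma mat_sum_quadratic_form:
  assumes A: "\<And>j. j \<in> S \<Longrightarrow> A j \<in> carrier_mat d d" and v: "v \<in> carrier_vec d"
  shows "v \<bullet> (mat_sum d A S *\<^sub>v v) = (\<Sum>j\<in>S. v \<bullet> (A j *\<^sub>v v))"
proof -
  have form: "v \<bullet> (B *\<^sub>v v) = (\<Sum>p<d. \<Sum>q<d. v $ p * (B $$ (p, q) * v $ q))"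
    if "B \<in> carrier_mat d d" for B
    using that v by (auto simp: scalar_prod_def sum_distrib_left lessThan_atLeast0)
  have "v \<bullet> (mat_sum d A S *\<^sub>v v) = (\<Sum>p<d. \<Sum>q<d. \<Sum>j\<in>S. v $ p * (A j $$ (p, q) * v $ q))"
    by (subst form) (simp_all add: mat_sum_def sum_distrib_left sum_distrib_right)
  \<comment> \<open>The sum over j moves outward, first past q and then past p.\<close>
  also have "\<dots> = (\<Sum>p<d. \<Sum>j\<in>S. \<Sum>q<d. v $ p * (A j $$ (p, q) * v $ q))"
    by (intro sum.cong refl sum.swap)
  also have "\<dots> = (\<Sum>j\<in>S. \<Sum>p<d. \<Sum>q<d. v $ p * (A j $$ (p, q) * v $ q))"
    by (rule sum.swap)
  also have "\<dots> = (\<Sum>j\<in>S. v \<bullet> (A j *\<^sub>v v))"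
    by (intro sum.cong refl form[symmetric] A)
  finally show ?thesis .
qed

lemma smult_mat_mult_vec:
  fixes A :: "'a::comm_ring mat"
  assumes "A \<in> carrier_mat r c" "v \<in> carrier_vec c"
  shows "(a \<cdot>\<^sub>m A) *\<^sub>v v = a \<cdot>\<^sub>v (A *\<^sub>v v)"
  using assms by (intro eq_vecI) auto

lemma Z_nbr_carrier:
  assumes "finite S" "Z j \<in> carrier_mat (n j) (n j)"
  shows "Z_nbr M n Z S j \<in> carrier_mat (\<Sum>k\<in>S. n k) (\<Sum>k\<in>S. n k)"
proof -
  have "(sel_W M n S)\<^sup>T \<in> carrier_mat (\<Sum>k\<in>{1..M}. n k) (\<Sum>k\<in>S. n k)"
    using sel_W_carrier[OF assms(1)] by simp
  moreover have "(sel_U M n j)\<^sup>T \<in> carrier_mat (\<Sum>k\<in>{1..M}. n k) (n j)"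
    using sel_U_carrier by simp
  ultimately show ?thesis
    unfolding Z_nbr_def by (meson mult_carrier_mat sel_W_carrier sel_U_carrier assms)
qed

text \<open>The only place where semidefiniteness of the LMI is used. The inequality is
  nonnegativity of b - 2 r A s + s^T Q s, the value of the quadratic form at (-1, s).\<close>

lemma lmi_mat_linear_bound:
  assumes r: "r \<in> carrier_mat 1 p" and A: "A \<in> carrier_mat p p" "A\<^sup>T = A"
    and Q: "Q \<in> carrier_mat p p" and s: "s \<in> carrier_vec p"
    and psd: "pos_semidef (1 + p) (lmi_mat b r A Q)"
  shows "2 * (row r 0 \<bullet> (A *\<^sub>v s)) \<le> b + s \<bullet> (Q *\<^sub>v s)"
proof -
  let ?B = "mat 1 1 (\<lambda>_. b)" and ?w = "(r * A) *\<^sub>v s"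
  \<comment> \<open>The entry -1 gives the cross terms a negative sign, so that they are bounded
    from above.\<close>
  define a :: "real vec" where "a = vec 1 (\<lambda>_. - 1)"
  have a: "a \<in> carrier_vec 1" by (simp add: a_def)
  have B: "?B \<in> carrier_mat 1 1" by simp
  have rA: "r * A \<in> carrier_mat 1 p" using r A by simp
  \<comment> \<open>Symmetry of A makes the off-diagonal blocks transposes of each other, so only
    \<open>r * A\<close> has to be handled.\<close>
  have eq: "A * r\<^sup>T = (r * A)\<^sup>T" using transpose_mult[OF r A(1)] A(2) by simp
  have C: "(r * A)\<^sup>T \<in> carrier_mat p 1" using rA by simp
  have w: "?w \<in> carrier_vec 1" using rA s by simp
  have Ba: "?B *\<^sub>v a \<in> carrier_vec 1" by (rule mult_mat_vec_carrier[OF B a])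
  have Ca: "(r * A)\<^sup>T *\<^sub>v a \<in> carrier_vec p" by (rule mult_mat_vec_carrier[OF C a])
  have Qs: "Q *\<^sub>v s \<in> carrier_vec p" by (rule mult_mat_vec_carrier[OF Q s])
  have neg: "a \<bullet> u = - u $ 0" if "u \<in> carrier_vec 1" for u
    using that by (simp add: a_def scalar_prod_def)
  \<comment> \<open>The cross term of the lower left block is moved onto that of the upper right
    block.\<close>
  have "s \<bullet> ((r * A)\<^sup>T *\<^sub>v a) = ((r * A)\<^sup>T *\<^sub>v a) \<bullet> s"
    using s Ca by (rule comm_scalar_prod)
  also have "\<dots> = a \<bullet> ?w" by (rule transpose_vec_mult_scalar[OF rA s a])
  finally have sym: "s \<bullet> ((r * A)\<^sup>T *\<^sub>v a) = a \<bullet> ?w" .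
  have "0 \<le> (a @\<^sub>v s) \<bullet> (lmi_mat b r A Q *\<^sub>v (a @\<^sub>v s))"
    using psd append_carrier_vec[OF a s] unfolding pos_semidef_def by blast
  also have "lmi_mat b r A Q *\<^sub>v (a @\<^sub>v s) = (?B *\<^sub>v a + ?w) @\<^sub>v ((r * A)\<^sup>T *\<^sub>v a + Q *\<^sub>v s)"
    unfolding lmi_mat_def eq by (rule four_block_mat_mult_vec[OF B rA C Q a s])
  also have "(a @\<^sub>v s) \<bullet> \<dots> = a \<bullet> (?B *\<^sub>v a + ?w) + s \<bullet> ((r * A)\<^sup>T *\<^sub>v a + Q *\<^sub>v s)"
    by (rule scalar_prod_append[OF a s add_carrier_vec[OF Ba w] add_carrier_vec[OF Ca Qs]])
  \<comment> \<open>By \<open>sym\<close> the two cross terms coincide, whence the factor 2.\<close>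
  also have "\<dots> = a \<bullet> (?B *\<^sub>v a) + 2 * (a \<bullet> ?w) + s \<bullet> (Q *\<^sub>v s)"
    unfolding scalar_prod_add_distrib[OF a Ba w] scalar_prod_add_distrib[OF s Ca Qs] sym by simp
  also have "a \<bullet> (?B *\<^sub>v a) = b"
    using neg[OF Ba] by (simp add: a_def scalar_prod_def)
  also have "a \<bullet> ?w = - (row r 0 \<bullet> (A *\<^sub>v s))"
    using neg[OF w] r A(1) s by (simp add: assoc_mult_mat_vec[OF r A(1) s])
  finally show ?thesis by simp
qed

text \<open>The sufficient direction of the S-procedure: the \<tau> j are multipliers for the
  M-block constraints s_j^T Z_j s_j \<le> 1, j in S. The row r is arbitrary, so that one argument
  covers state and input constraints.\<close>

lemma lmi_implies_terminal_bound:
  assumes S: "S \<subseteq> {1..M}" and \<alpha>: "\<forall>j\<in>S. \<alpha> j > 0"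
    and Z: "\<forall>j\<in>S. Z j \<in> carrier_mat (n j) (n j)"
    and r: "r \<in> carrier_mat 1 (\<Sum>j\<in>S. n j)" and \<tau>: "\<forall>j\<in>S. \<tau> j \<ge> 0"
    and psd: "pos_semidef (1 + (\<Sum>j\<in>S. n j))
      (lmi_mat b r (alpha_nbr_sqrt n \<alpha> S)
        (mat_sum (\<Sum>j\<in>S. n j) (\<lambda>j. \<tau> j \<cdot>\<^sub>m Z_nbr M n Z S j) S))"
    and le: "(\<Sum>j\<in>S. \<tau> j) \<le> b" and x: "x \<in> nbr_term_set n Z \<alpha> S"
  shows "row r 0 \<bullet> x \<le> b"
proof -
  let ?d = "\<Sum>j\<in>S. n j" and ?R = "alpha_nbr_sqrt n \<alpha> S"
  let ?Q = "mat_sum ?d (\<lambda>j. \<tau> j \<cdot>\<^sub>m Z_nbr M n Z S j) S"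
  have fin: "finite S" using S finite_subset by blast
  obtain y where xy: "x = nbr_vec S y" and y: "\<forall>j\<in>S. y j \<in> term_set (n j) (Z j) (\<alpha> j)"
    using x by (auto simp: nbr_term_set_def)
  \<comment> \<open>Scaling by 1 / sqrt (\<alpha> j) carries the ellipsoid of level \<alpha> j to
    the one of level 1, which makes the bound on the multiplier sum independent of \<alpha>.\<close>
  define t where "t j = (1 / sqrt (\<alpha> j)) \<cdot>\<^sub>v y j" for j
  let ?s = "nbr_vec S t"
  have yc: "\<forall>j\<in>S. y j \<in> carrier_vec (n j)" using y by (simp add: term_set_def)
  then have tc: "\<forall>j\<in>S. t j \<in> carrier_vec (n j)" by (simp add: t_def)
  have s: "?s \<in> carrier_vec ?d" using fin tc by (rule nbr_vec_carrier)
  have R: "?R \<in> carrier_mat ?d ?d" "?R\<^sup>T = ?R"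
    using pos_semidef_alpha_nbr_sqrt[OF fin \<alpha>, of n] by (auto simp: pos_semidef_def)
  have Q: "?Q \<in> carrier_mat ?d ?d" by (simp add: mat_sum_def)
  \<comment> \<open>\<open>?R\<close> multiplies block j by sqrt (\<alpha> j), which is nonzero, and
    so undoes the scaling.\<close>
  have Rs: "?R *\<^sub>v ?s = x"
    unfolding alpha_nbr_sqrt_mult[OF fin tc] unfolding xy nbr_vec_def
  proof (rule block_vec_cong)
    fix j assume "j \<in> set (sorted_list_of_set S)"
    then have "\<alpha> j > 0" using \<alpha> fin by simp
    then show "sqrt (\<alpha> j) \<cdot>\<^sub>v t j = y j" by (simp add: t_def smult_smult_assoc)
  qed
  have form_le: "t j \<bullet> (Z j *\<^sub>v t j) \<le> 1" if j: "j \<in> S" for j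
  proof -
    have aj: "\<alpha> j > 0" and Zj: "Z j \<in> carrier_mat (n j) (n j)" and yj: "y j \<in> carrier_vec (n j)"
      using \<alpha> Z yc j by auto
    \<comment> \<open>Each of the two arguments contributes a factor 1 / sqrt (\<alpha> j).\<close>
    have "t j \<bullet> (Z j *\<^sub>v t j) = (y j \<bullet> (Z j *\<^sub>v y j)) / \<alpha> j"
      using Zj yj aj by (simp add: t_def mult_mat_vec[OF Zj yj])
    also have "\<dots> \<le> 1" using y j aj by (simp add: term_set_def)
    finally show ?thesis .
  qed
  have ZN: "Z_nbr M n Z S j \<in> carrier_mat ?d ?d" if "j \<in> S" for j
    using fin Z that by (intro Z_nbr_carrier) auto
  have "?s \<bullet> (?Q *\<^sub>v ?s) = (\<Sum>j\<in>S. ?s \<bullet> ((\<tau> j \<cdot>\<^sub>m Z_nbr M n Z S j) *\<^sub>v ?s))"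
    using ZN s by (intro mat_sum_quadratic_form) auto
  \<comment> \<open>Each \<open>Z_nbr\<close> sees only block j of the stacked vector, so the form
    splits into one term per neighbor.\<close>
  also have "\<dots> = (\<Sum>j\<in>S. \<tau> j * (t j \<bullet> (Z j *\<^sub>v t j)))"
  proof (intro sum.cong refl)
    fix j assume j: "j \<in> S"
    have "?s \<bullet> ((\<tau> j \<cdot>\<^sub>m Z_nbr M n Z S j) *\<^sub>v ?s) = \<tau> j * (?s \<bullet> (Z_nbr M n Z S j *\<^sub>v ?s))"
      using ZN[OF j] s by (simp add: smult_mat_mult_vec)
    then show "?s \<bullet> ((\<tau> j \<cdot>\<^sub>m Z_nbr M n Z S j) *\<^sub>v ?s) = \<tau> j * (t j \<bullet> (Z j *\<^sub>v t j))"
      using Z_nbr_quadratic_form[OF tc S j] Z j by simp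
  qed
  \<comment> \<open>Nonnegative weights times values that are at most 1.\<close>
  also have "\<dots> \<le> (\<Sum>j\<in>S. \<tau> j)"
    using form_le \<tau> by (intro sum_mono mult_left_le) auto
  finally have "?s \<bullet> (?Q *\<^sub>v ?s) \<le> b" using le by simp
  \<comment> \<open>The corner entry b and the bound on the form together give 2 r x \<le> b + b;
    halving gives the claim.\<close>
  then show ?thesis
    using lmi_mat_linear_bound[OF r R Q s psd] unfolding Rs by simp
qed

theorem theorem3:
  fixes M :: nat
    and n m n_g n_h :: "nat \<Rightarrow> nat"
    and N :: "nat \<Rightarrow> nat set"
    and G H Z :: "nat \<Rightarrow> real mat"
    and g h :: "nat \<Rightarrow> real vec"
    and \<alpha> :: "nat \<Rightarrow> real"
    and i :: nat
  assumes "\<forall>k\<in>{1..M}. N k \<subseteq> {1..M}"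
    and "\<forall>k\<in>{1..M}. G k \<in> carrier_mat (n_g k) (\<Sum>j\<in>N k. n j) \<and> g k \<in> carrier_vec (n_g k)"
    and "\<forall>k\<in>{1..M}. H k \<in> carrier_mat (n_h k) (m k) \<and> h k \<in> carrier_vec (n_h k)"
    and "\<forall>k\<in>{1..M}. origin_in_interior (\<Sum>j\<in>N k. n j) (polyhedron (\<Sum>j\<in>N k. n j) (G k) (g k))"
    and "\<forall>k\<in>{1..M}. origin_in_interior (m k) (polyhedron (m k) (H k) (h k))"
    and "\<forall>j\<in>{1..M}. \<alpha> j > 0"
    and "\<forall>j\<in>{1..M}. pos_def (n j) (Z j)"
    and "i \<in> {1..M}"
  shows
    "(\<forall>l<n_g i.
        (\<exists>\<tau> :: nat \<Rightarrow> real. (\<forall>j\<in>N i. \<tau> j \<ge> 0) \<and>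
           pos_semidef (1 + (\<Sum>j\<in>N i. n j))
             (lmi_mat (g i $ l) (mat_of_row (row (G i) l)) (alpha_nbr_sqrt n \<alpha> (N i))
               (mat_sum (\<Sum>j\<in>N i. n j) (\<lambda>j. \<tau> j \<cdot>\<^sub>m Z_nbr M n Z (N i) j) (N i))) \<and>
           (\<Sum>j\<in>N i. \<tau> j) \<le> g i $ l) \<longrightarrow>
        (\<forall>x\<in>nbr_term_set n Z \<alpha> (N i). row (G i) l \<bullet> x \<le> g i $ l)) \<and>
     (\<forall>K\<in>carrier_mat (m i) (\<Sum>j\<in>N i. n j). \<forall>l<n_h i.
        (\<exists>\<rho> :: nat \<Rightarrow> real. (\<forall>j\<in>N i. \<rho> j \<ge> 0) \<and>
           pos_semidef (1 + (\<Sum>j\<in>N i. n j))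
             (lmi_mat (h i $ l) (mat_of_row (row (H i) l) * K) (alpha_nbr_sqrt n \<alpha> (N i))
               (mat_sum (\<Sum>j\<in>N i. n j) (\<lambda>j. \<rho> j \<cdot>\<^sub>m Z_nbr M n Z (N i) j) (N i))) \<and>
           (\<Sum>j\<in>N i. \<rho> j) \<le> h i $ l) \<longrightarrow>
        (\<forall>x\<in>nbr_term_set n Z \<alpha> (N i). row (H i) l \<bullet> (K *\<^sub>v x) \<le> h i $ l))"
proof -
  let ?d = "\<Sum>j\<in>N i. n j"
  have S: "N i \<subseteq> {1..M}" using assms(1,8) by blast
  have \<alpha>: "\<forall>j\<in>N i. \<alpha> j > 0" using assms(6) S by blast
  have Z: "\<forall>j\<in>N i. Z j \<in> carrier_mat (n j) (n j)" using assms(7) S by (auto simp: pos_def_def)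
  note bound = lmi_implies_terminal_bound[OF S \<alpha> Z]
  have G: "row (G i) l \<bullet> x \<le> g i $ l"
    if "\<forall>j\<in>N i. \<tau> j \<ge> 0"
      "pos_semidef (1 + ?d) (lmi_mat (g i $ l) (mat_of_row (row (G i) l)) (alpha_nbr_sqrt n \<alpha> (N i))
        (mat_sum ?d (\<lambda>j. \<tau> j \<cdot>\<^sub>m Z_nbr M n Z (N i) j) (N i)))"
      "(\<Sum>j\<in>N i. \<tau> j) \<le> g i $ l" "x \<in> nbr_term_set n Z \<alpha> (N i)" for l \<tau> x
  proof -
    \<comment> \<open>The dimension is what remains to be checked: row 0 of
      \<open>mat_of_row\<close> is the given row.\<close>
    have "row (G i) l \<in> carrier_vec ?d" using assms(2,8) by (metis carrier_matD(2) row_carrier)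
    then show ?thesis using bound[OF _ that] by simp
  qed
  have H: "row (H i) l \<bullet> (K *\<^sub>v x) \<le> h i $ l"
    if K: "K \<in> carrier_mat (m i) ?d" and rho: "\<forall>j\<in>N i. \<rho> j \<ge> 0"
      "pos_semidef (1 + ?d) (lmi_mat (h i $ l) (mat_of_row (row (H i) l) * K) (alpha_nbr_sqrt n \<alpha> (N i))
        (mat_sum ?d (\<lambda>j. \<rho> j \<cdot>\<^sub>m Z_nbr M n Z (N i) j) (N i)))"
      "(\<Sum>j\<in>N i. \<rho> j) \<le> h i $ l" and x: "x \<in> nbr_term_set n Z \<alpha> (N i)" for l \<rho> x K
  proof -
    have "row (H i) l \<in> carrier_vec (m i)" using assms(3,8) by (metis carrier_matD(2) row_carrier)
    then have r: "mat_of_row (row (H i) l) \<in> carrier_mat 1 (m i)" by simp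
    \<comment> \<open>The length of x is needed to reassociate (r K) x as r (K x) below.\<close>
    have xc: "x \<in> carrier_vec ?d"
      using x finite_subset[OF S] by (auto simp: nbr_term_set_def term_set_def intro!: nbr_vec_carrier)
    have rK: "mat_of_row (row (H i) l) * K \<in> carrier_mat 1 ?d" using r K by (rule mult_carrier_mat)
    \<comment> \<open>With the 1-row matrix r K as its row, the general bound speaks of (r K) x. Its
      only entry is row l of \<open>H i\<close> applied to the input K x.\<close>
    have "row (mat_of_row (row (H i) l) * K) 0 \<bullet> x = ((mat_of_row (row (H i) l) * K) *\<^sub>v x) $ 0"
      using rK by simp
    also have "\<dots> = row (H i) l \<bullet> (K *\<^sub>v x)"
      by (simp add: assoc_mult_mat_vec[OF r K xc])
    finally show ?thesis using bound[OF rK rho x] by simp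
  qed
  show ?thesis using G H by blast
qed

end
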